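(* Let $\mathcal{A}$ be an additive category and let $X$ be an object of $\mathcal{A}$. Suppose there are two direct sum decompositions \[X_1\oplus\cdots\oplus X_r = X = Y_1\oplus\cdots\oplus Y_s\] such that all the objects $X_i$ ($1\le i\le r$) and $Y_j$ ($1\le j\le s$) have local endomorphism rings. Then $r=s$ and there exists a permutation $\pi$ of $\{1,\ldots,r\}$ such that $X_i\cong Y_{\pi(i)}$ for $1\le i\le r$.
   Context: An additive category is a category whose morphism sets are abelian groups with bilinear composition, which has a zero object and in which every pair of objects has a product. A decomposition $X=X_1\oplus\cdots\oplus X_r$ means that there are morphisms $\iota_i\colon X_i\to X$ and $\pi_i\colon X\to X_i$ with $\sum_i\iota_i\pi_i=\mathrm{id}_X$, $\pi_i\iota_i=\mathrm{id}_{X_i}$ for all $i$ and $\pi_j\iota_i=0$ for $i\ne j$ (a finite biproduct). A non-zero ring is local if the sum of two non-units is again a non-unit. The category is not assumed to have split idempotents. *)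

theory Defs
  imports "HOL-Algebra.Ring" "HOL-Combinatorics.Permutations"
begin

record ('o, 'm) category =
  Obj :: "'o set"
  Arr :: "'m set"
  Dom :: "'m \<Rightarrow> 'o"
  Cod :: "'m \<Rightarrow> 'o"
  Ident :: "'o \<Rightarrow> 'm"
  Comp :: "'m \<Rightarrow> 'm \<Rightarrow> 'm" (infixr "\<cdot>\<index>" 70)

definition Hom :: "('o, 'm, 'e) category_scheme \<Rightarrow> 'o \<Rightarrow> 'o \<Rightarrow> 'm set" where
  "Hom C a b = {f \<in> Arr C. Dom C f = a \<and> Cod C f = b}"

text \<open>Composition is written in the usual order: \<open>g \<cdot> f\<close> is first \<open>f\<close>, then \<open>g\<close>. Nothing is
  required of it on pairs that are not composable.\<close>

locale category =
  fixes C (structure)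
  assumes Dom_closed: "f \<in> Arr C \<Longrightarrow> Dom C f \<in> Obj C"
    and Cod_closed: "f \<in> Arr C \<Longrightarrow> Cod C f \<in> Obj C"
    and Ident_closed: "a \<in> Obj C \<Longrightarrow> Ident C a \<in> Hom C a a"
    and Comp_closed: "f \<in> Hom C a b \<Longrightarrow> g \<in> Hom C b c \<Longrightarrow> g \<cdot> f \<in> Hom C a c"
    and Comp_Ident: "f \<in> Hom C a b \<Longrightarrow> f \<cdot> Ident C a = f"
    and Ident_Comp: "f \<in> Hom C a b \<Longrightarrow> Ident C b \<cdot> f = f"
    and Comp_assoc: "f \<in> Hom C a b \<Longrightarrow> g \<in> Hom C b c \<Longrightarrow> h \<in> Hom C c d
      \<Longrightarrow> (h \<cdot> g) \<cdot> f = h \<cdot> (g \<cdot> f)"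

definition isomorphic :: "('o, 'm, 'e) category_scheme \<Rightarrow> 'o \<Rightarrow> 'o \<Rightarrow> bool" where
  "isomorphic C a b \<longleftrightarrow> (\<exists>f \<in> Hom C a b. \<exists>g \<in> Hom C b a.
     Comp C g f = Ident C a \<and> Comp C f g = Ident C b)"

definition zero_object :: "('o, 'm, 'e) category_scheme \<Rightarrow> 'o \<Rightarrow> bool" where
  "zero_object C z \<longleftrightarrow> z \<in> Obj C \<and>
     (\<forall>a \<in> Obj C. (\<exists>!f. f \<in> Hom C z a) \<and> (\<exists>!f. f \<in> Hom C a z))"

definition is_product ::
  "('o, 'm, 'e) category_scheme \<Rightarrow> 'o \<Rightarrow> 'o \<Rightarrow> 'o \<Rightarrow> 'm \<Rightarrow> 'm \<Rightarrow> bool" where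
  "is_product C a b p p1 p2 \<longleftrightarrow> p \<in> Obj C \<and> p1 \<in> Hom C p a \<and> p2 \<in> Hom C p b \<and>
     (\<forall>c \<in> Obj C. \<forall>f \<in> Hom C c a. \<forall>g \<in> Hom C c b.
        \<exists>!h. h \<in> Hom C c p \<and> Comp C p1 h = f \<and> Comp C p2 h = g)"

record ('o, 'm) preadditive_category = "('o, 'm) category" +
  Add :: "'m \<Rightarrow> 'm \<Rightarrow> 'm" (infixl "\<boxplus>\<index>" 65)
  Zero :: "'o \<Rightarrow> 'o \<Rightarrow> 'm"

definition Hom_group ::
  "('o, 'm, 'e) preadditive_category_scheme \<Rightarrow> 'o \<Rightarrow> 'o \<Rightarrow> 'm monoid" where
  "Hom_group C a b = \<lparr>carrier = Hom C a b, monoid.mult = Add C, one = Zero C a b\<rparr>"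

definition End_ring :: "('o, 'm, 'e) preadditive_category_scheme \<Rightarrow> 'o \<Rightarrow> 'm ring" where
  "End_ring C a = \<lparr>carrier = Hom C a a, monoid.mult = Comp C, one = Ident C a,
     zero = Zero C a a, add = Add C\<rparr>"

locale additive_category = category +
  assumes Hom_comm_group:
      "a \<in> Obj C \<Longrightarrow> b \<in> Obj C \<Longrightarrow> comm_group (Hom_group C a b)"
    and Comp_Add_left: "f \<in> Hom C a b \<Longrightarrow> g \<in> Hom C b c \<Longrightarrow> g' \<in> Hom C b c
      \<Longrightarrow> (g \<boxplus> g') \<cdot> f = (g \<cdot> f) \<boxplus> (g' \<cdot> f)"
    and Comp_Add_right: "f \<in> Hom C a b \<Longrightarrow> f' \<in> Hom C a b \<Longrightarrow> g \<in> Hom C b c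
      \<Longrightarrow> g \<cdot> (f \<boxplus> f') = (g \<cdot> f) \<boxplus> (g \<cdot> f')"
    and ex_zero_object: "\<exists>z. zero_object C z"
    and ex_product: "a \<in> Obj C \<Longrightarrow> b \<in> Obj C \<Longrightarrow> \<exists>p p1 p2. is_product C a b p p1 p2"

lemma (in additive_category) ring_End_ring:
  assumes a: "a \<in> Obj C"
  shows "ring (End_ring C a)"
proof -
  have g: "comm_group (Hom_group C a a)" using Hom_comm_group a by blast
  have 1: "abelian_group (End_ring C a)"
  proof (rule abelian_groupI)
    fix x assume "x \<in> carrier (End_ring C a)"
    then show "\<exists>y \<in> carrier (End_ring C a). y \<oplus>\<^bsub>End_ring C a\<^esub> x = \<zero>\<^bsub>End_ring C a\<^esub>"
      using group.l_inv_ex[OF comm_group.axioms(2)[OF g]]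
      by (auto simp: Hom_group_def End_ring_def)
  next
    interpret comm_group "Hom_group C a a" by (rule g)
    show "\<zero>\<^bsub>End_ring C a\<^esub> \<in> carrier (End_ring C a)"
      using one_closed by (simp add: Hom_group_def End_ring_def)
    fix x y assume "x \<in> carrier (End_ring C a)" "y \<in> carrier (End_ring C a)"
    then show "x \<oplus>\<^bsub>End_ring C a\<^esub> y \<in> carrier (End_ring C a)"
        "x \<oplus>\<^bsub>End_ring C a\<^esub> y = y \<oplus>\<^bsub>End_ring C a\<^esub> x"
        "\<zero>\<^bsub>End_ring C a\<^esub> \<oplus>\<^bsub>End_ring C a\<^esub> x = x"
      using m_closed[of x y] m_comm[of x y] l_one[of x]
      by (auto simp: Hom_group_def End_ring_def)
    fix z assume "z \<in> carrier (End_ring C a)"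
    with \<open>x \<in> _\<close> \<open>y \<in> _\<close> show "(x \<oplus>\<^bsub>End_ring C a\<^esub> y) \<oplus>\<^bsub>End_ring C a\<^esub> z =
        x \<oplus>\<^bsub>End_ring C a\<^esub> (y \<oplus>\<^bsub>End_ring C a\<^esub> z)"
      using m_assoc[of x y z] by (simp add: Hom_group_def End_ring_def)
  qed
  have 2: "monoid (End_ring C a)"
    by (rule monoidI)
      (auto simp: End_ring_def a Ident_closed Comp_Ident Ident_Comp
        intro: Comp_closed Comp_assoc)
  show ?thesis
    by (rule ringI[OF 1 2]) (auto simp: End_ring_def intro: Comp_Add_left Comp_Add_right)
qed

text \<open>Rings need not be commutative; \<^const>\<open>Units\<close> are the two-sided invertible elements.\<close>

locale local_ring = ring +
  assumes carrier_nonzero: "carrier R \<noteq> {\<zero>}"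
    and nonunits_add: "x \<in> carrier R - Units R \<Longrightarrow> y \<in> carrier R - Units R
      \<Longrightarrow> x \<oplus> y \<notin> Units R"

text \<open>The empty decomposition \<open>r = 0\<close> is allowed; it forces the identity of \<open>X\<close> to be zero.\<close>

definition direct_sum_decomposition ::
  "('o, 'm, 'e) preadditive_category_scheme \<Rightarrow> 'o \<Rightarrow> nat \<Rightarrow> (nat \<Rightarrow> 'o) \<Rightarrow> bool" where
  "direct_sum_decomposition C X r Xs \<longleftrightarrow>
     X \<in> Obj C \<and> (\<forall>i \<in> {1..r}. Xs i \<in> Obj C) \<and>
     (\<exists>\<iota> \<pi>.
        (\<forall>i \<in> {1..r}. \<iota> i \<in> Hom C (Xs i) X \<and> \<pi> i \<in> Hom C X (Xs i)) \<and>
        finsum (End_ring C X) (\<lambda>i. Comp C (\<iota> i) (\<pi> i)) {1..r} = Ident C X \<and>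
        (\<forall>i \<in> {1..r}. Comp C (\<pi> i) (\<iota> i) = Ident C (Xs i)) \<and>
        (\<forall>i \<in> {1..r}. \<forall>j \<in> {1..r}. i \<noteq> j \<longrightarrow> Comp C (\<pi> j) (\<iota> i) = Zero C (Xs i) (Xs j)))"

end

theory Submission imports Defs begin

text \<open>
  Composing the inclusions of one decomposition with the projections of the other one gives two
  mutually inverse matrices \<open>a\<close> and \<open>b\<close> of morphisms between the families \<open>X\<^sub>i\<close> and \<open>Y\<^sub>j\<close>. In the
  local ring \<open>End X\<^sub>i\<close> the identity is \<open>\<Sum>\<^sub>j b\<^sub>i\<^sub>j a\<^sub>j\<^sub>i\<close>, so some summand is a unit; since \<open>End Y\<^sub>j\<close> is
  local as well, the corresponding entry \<open>a\<^sub>j\<^sub>i\<close> is an isomorphism. One step of Gaussian elimination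
  removes row \<open>j\<close> and column \<open>i\<close>: the Schur complement of \<open>a\<^sub>j\<^sub>i\<close> in \<open>a\<close> is inverse to the remaining
  block of \<open>b\<close>. Working with matrices instead of subobjects avoids splitting idempotents.
\<close>

section \<open>Local rings: unit summands and idempotents\<close>

lemma (in local_ring) zero_nonunit: "\<zero> \<notin> Units R"
proof
  assume "\<zero> \<in> Units R"
  then obtain y where "y \<in> carrier R" "y \<otimes> \<zero> = \<one>" by (auto simp: Units_def)
  then show False using carrier_nonzero carrier_one_zero by simp
qed

text \<open>The contrapositive of \<open>nonunits_add\<close>, iterated over \<open>S\<close>; the
  empty sum is excluded because zero is not a unit. It extracts an invertible summand from a sum
  equal to the identity.\<close>

lemma (in local_ring) finsum_unit_summand:
  assumes "finite S" "f \<in> S \<rightarrow> carrier R" "finsum R f S \<in> Units R"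
  shows "\<exists>x \<in> S. f x \<in> Units R"
  using assms
proof (induction S rule: finite_induct)
  case empty
  then show ?case using zero_nonunit by simp
next
  case (insert x S)
  then have "finsum R f (insert x S) = f x \<oplus> finsum R f S"
    by (intro finsum_insert) auto
  moreover have "f x \<in> carrier R" "finsum R f S \<in> carrier R" using insert.prems by auto
  ultimately show ?case
    using nonunits_add[of "f x" "finsum R f S"] insert by auto
qed

text \<open>Since \<open>e\<close> and \<open>\<one> \<ominus> e\<close> add up to a unit, one of
  them is a unit; both are idempotent, and an idempotent unit is \<open>\<one>\<close> by
  cancellation. This is what later turns a one-sided inverse into a two-sided one.\<close>

lemma (in local_ring) idempotent_cases:
  assumes e: "e \<in> carrier R" "e \<otimes> e = e"
  shows "e = \<zero> \<or> e = \<one>"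
proof -
  have unit_idem: "x = \<one>" if "x \<in> Units R" "x \<otimes> x = x" for x
    using that Units_l_cancel[of x x \<one>] by (simp add: Units_closed)
  have "e \<oplus> (\<one> \<ominus> e) = \<one>" using e by algebra
  then consider "e \<in> Units R" | "\<one> \<ominus> e \<in> Units R"
    using nonunits_add[of e "\<one> \<ominus> e"] e by auto
  then show ?thesis
  proof cases
    case 1
    then show ?thesis using unit_idem e by blast
  next
    case 2
    have "(\<one> \<ominus> e) \<otimes> (\<one> \<ominus> e) = \<one> \<ominus> e \<ominus> e \<oplus> e \<otimes> e"
      using e(1) by (simp add: minus_eq l_distr r_distr l_minus r_minus a_ac minus_add)
    also have "\<dots> = \<one> \<ominus> e" unfolding e(2) using e(1) by algebra
    finally have "\<one> \<ominus> e = \<one>" using unit_idem 2 by blast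
    moreover have "e = \<one> \<ominus> (\<one> \<ominus> e)" using e(1) by algebra
    ultimately show ?thesis using e(1) by (simp add: minus_eq r_neg)
  qed
qed

section \<open>Finite sums of morphisms and their compatibility with composition\<close>

context additive_category
begin

lemma Hom_Obj: "f \<in> Hom C a b \<Longrightarrow> a \<in> Obj C \<and> b \<in> Obj C"
  using Dom_closed Cod_closed by (auto simp: Hom_def)

text \<open>\<open>Hom_group\<close> is a multiplicative record, so \<open>finprod\<close> in it is
  a finite sum of morphisms. Unlike \<open>finsum\<close> in \<open>End_ring\<close>, it allows
  different source and target.\<close>

abbreviation hom_sum where "hom_sum a b \<equiv> finprod (Hom_group C a b)"

lemma Hom_group_simps [simp]:
  "carrier (Hom_group C a b) = Hom C a b"
  "x \<otimes>\<^bsub>Hom_group C a b\<^esub> y = x \<boxplus> y"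
  "\<one>\<^bsub>Hom_group C a b\<^esub> = Zero C a b"
  by (simp_all add: Hom_group_def)

lemma End_ring_simps [simp]:
  "carrier (End_ring C a) = Hom C a a"
  "x \<otimes>\<^bsub>End_ring C a\<^esub> y = x \<cdot> y"
  "\<one>\<^bsub>End_ring C a\<^esub> = Ident C a"
  "\<zero>\<^bsub>End_ring C a\<^esub> = Zero C a a"
  by (simp_all add: End_ring_def)

text \<open>Links the sum used in the definition of a decomposition to \<open>hom_sum\<close>:
  \<open>finsum\<close> is by definition \<open>finprod\<close> in the additive monoid of the ring,
  here \<open>Hom_group C a a\<close>.\<close>

lemma finsum_End_ring: "finsum (End_ring C a) f S = hom_sum a a f S"
  by (simp add: finsum_def End_ring_def Hom_group_def)

lemma Zero_closed:
  assumes "a \<in> Obj C" "b \<in> Obj C"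
  shows "Zero C a b \<in> Hom C a b"
proof -
  interpret G: comm_group "Hom_group C a b" using assms by (rule Hom_comm_group)
  show ?thesis using G.one_closed by simp
qed

lemma Add_closed:
  assumes "f \<in> Hom C a b" "g \<in> Hom C a b"
  shows "f \<boxplus> g \<in> Hom C a b"
proof -
  interpret G: comm_group "Hom_group C a b" using assms Hom_Obj by (blast intro: Hom_comm_group)
  show ?thesis using G.m_closed[of f g] assms by simp
qed

lemma Add_Zero:
  assumes "f \<in> Hom C a b"
  shows "f \<boxplus> Zero C a b = f" "Zero C a b \<boxplus> f = f"
proof -
  interpret G: comm_group "Hom_group C a b" using assms Hom_Obj by (blast intro: Hom_comm_group)
  show "f \<boxplus> Zero C a b = f" "Zero C a b \<boxplus> f = f" using G.r_one[of f] G.l_one[of f] assms by auto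
qed

text \<open>Serves to show that composites with zero morphisms vanish: bilinearity makes such a
  composite equal to its own double.\<close>

lemma Add_idem:
  assumes "f \<in> Hom C a b" "f \<boxplus> f = f"
  shows "f = Zero C a b"
proof -
  interpret G: comm_group "Hom_group C a b" using assms Hom_Obj by (blast intro: Hom_comm_group)
  show ?thesis using G.l_cancel_one[of f f] assms by simp
qed

lemma Comp_Zero:
  assumes "g \<in> Hom C b c" "a \<in> Obj C"
  shows "g \<cdot> Zero C a b = Zero C a c"
proof -
  have z: "Zero C a b \<in> Hom C a b" using assms Hom_Obj Zero_closed by blast
  show ?thesis
    using Comp_Add_right[OF z z assms(1)] Add_Zero[OF z] Comp_closed[OF z assms(1)]
    by (intro Add_idem) auto
qed

lemma Zero_Comp:
  assumes "f \<in> Hom C a b" "c \<in> Obj C"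
  shows "Zero C b c \<cdot> f = Zero C a c"
proof -
  have z: "Zero C b c \<in> Hom C b c" using assms Hom_Obj Zero_closed by blast
  show ?thesis
    using Comp_Add_left[OF assms(1) z z] Add_Zero[OF z] Comp_closed[OF assms(1) z]
    by (intro Add_idem) auto
qed

lemma hom_sum_closed:
  assumes "a \<in> Obj C" "b \<in> Obj C" "\<And>x. x \<in> S \<Longrightarrow> f x \<in> Hom C a b"
  shows "hom_sum a b f S \<in> Hom C a b"
proof -
  interpret G: comm_group "Hom_group C a b" using assms by (blast intro: Hom_comm_group)
  show ?thesis using G.finprod_closed[of f S] assms by auto
qed

lemma hom_sum_cong:
  assumes "a \<in> Obj C" "b \<in> Obj C" "\<And>x. x \<in> S \<Longrightarrow> f x \<in> Hom C a b"
    and "\<And>x. x \<in> S \<Longrightarrow> f x = g x"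
  shows "hom_sum a b f S = hom_sum a b g S"
proof -
  interpret G: comm_group "Hom_group C a b" using assms by (blast intro: Hom_comm_group)
  show ?thesis using assms by (intro G.finprod_cong') auto
qed

lemma hom_sum_insert:
  assumes "a \<in> Obj C" "b \<in> Obj C" "finite S" "x \<notin> S"
    and "\<And>y. y \<in> insert x S \<Longrightarrow> f y \<in> Hom C a b"
  shows "hom_sum a b f (insert x S) = f x \<boxplus> hom_sum a b f S"
proof -
  interpret G: comm_group "Hom_group C a b" using assms by (blast intro: Hom_comm_group)
  show ?thesis using G.finprod_insert[of S x f] assms by auto
qed

lemma hom_sum_empty:
  assumes "a \<in> Obj C" "b \<in> Obj C"
  shows "hom_sum a b f {} = Zero C a b"
proof -
  interpret G: comm_group "Hom_group C a b" using assms by (rule Hom_comm_group)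
  show ?thesis using G.finprod_empty by simp
qed

lemma hom_sum_Add:
  assumes "a \<in> Obj C" "b \<in> Obj C" "\<And>x. x \<in> S \<Longrightarrow> f x \<in> Hom C a b"
    and "\<And>x. x \<in> S \<Longrightarrow> g x \<in> Hom C a b"
  shows "hom_sum a b (\<lambda>x. f x \<boxplus> g x) S = hom_sum a b f S \<boxplus> hom_sum a b g S"
proof -
  interpret G: comm_group "Hom_group C a b" using assms by (blast intro: Hom_comm_group)
  show ?thesis using G.finprod_multf[of f S g] assms by auto
qed

lemma Comp_hom_sum:
  assumes "a \<in> Obj C" "g \<in> Hom C b c" "finite S" "\<And>x. x \<in> S \<Longrightarrow> f x \<in> Hom C a b"
  shows "g \<cdot> hom_sum a b f S = hom_sum a c (\<lambda>x. g \<cdot> f x) S"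
  using assms(3,4)
proof (induction S rule: finite_induct)
  case empty
  then show ?case using assms Hom_Obj Comp_Zero by (metis hom_sum_empty)
next
  case (insert x S)
  have ob: "b \<in> Obj C" "c \<in> Obj C" using assms Hom_Obj by blast+
  have "g \<cdot> hom_sum a b f (insert x S) = g \<cdot> (f x \<boxplus> hom_sum a b f S)"
    using insert ob assms by (subst hom_sum_insert) auto
  also have "\<dots> = g \<cdot> f x \<boxplus> g \<cdot> hom_sum a b f S"
    using insert ob assms by (intro Comp_Add_right[of _ a b _ _ c] hom_sum_closed) auto
  also have "\<dots> = hom_sum a c (\<lambda>x. g \<cdot> f x) (insert x S)"
    using insert ob assms by (subst hom_sum_insert) (auto intro: Comp_closed)
  finally show ?case .
qed

lemma hom_sum_Comp:
  assumes "c \<in> Obj C" "g \<in> Hom C a b" "finite S" "\<And>x. x \<in> S \<Longrightarrow> f x \<in> Hom C b c"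
  shows "hom_sum b c f S \<cdot> g = hom_sum a c (\<lambda>x. f x \<cdot> g) S"
  using assms(3,4)
proof (induction S rule: finite_induct)
  case empty
  then show ?case using assms Hom_Obj Zero_Comp by (metis hom_sum_empty)
next
  case (insert x S)
  have ob: "a \<in> Obj C" "b \<in> Obj C" using assms Hom_Obj by blast+
  have "hom_sum b c f (insert x S) \<cdot> g = (f x \<boxplus> hom_sum b c f S) \<cdot> g"
    using insert ob assms by (subst hom_sum_insert) auto
  also have "\<dots> = f x \<cdot> g \<boxplus> hom_sum b c f S \<cdot> g"
    using insert ob assms by (intro Comp_Add_left[of _ a b _ c] hom_sum_closed) auto
  also have "\<dots> = hom_sum a c (\<lambda>x. f x \<cdot> g) (insert x S)"
    using insert ob assms by (subst hom_sum_insert) (auto intro: Comp_closed)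
  finally show ?case .
qed

section \<open>Matrices of morphisms, elimination and the matching of indices\<close>

lemma iso_neg_inverse:
  assumes u: "u \<in> Hom C x y" and v: "v \<in> Hom C y x"
    and uv: "u \<cdot> v = Ident C y" and vu: "v \<cdot> u = Ident C x"
  obtains z where "z \<in> Hom C y x" "Ident C y \<boxplus> u \<cdot> z = Zero C y y" "Ident C x \<boxplus> z \<cdot> u = Zero C x x"
proof -
  have ob: "x \<in> Obj C" "y \<in> Obj C" using u Hom_Obj by blast+
  \<comment> \<open>The witness \<open>z\<close> is minus \<open>v\<close>. Signs are expressed by
    sums equal to zero, so no notation for negatives of morphisms is required.\<close>
  interpret G: comm_group "Hom_group C y x" using ob by (intro Hom_comm_group)
  obtain z where z: "z \<in> Hom C y x" "v \<boxplus> z = Zero C y x"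
    using G.r_inv_ex[of v] v by auto
  have "Ident C y \<boxplus> u \<cdot> z = Zero C y y"
    using Comp_Add_right[OF v z(1) u] z uv Comp_Zero[OF u ob(2)] by simp
  moreover have "Ident C x \<boxplus> z \<cdot> u = Zero C x x"
    using Comp_Add_left[OF u v z(1)] z vu Zero_Comp[OF u ob(1)] by simp
  ultimately show ?thesis using z that by blast
qed

text \<open>The entry in row \<open>i\<close> and column \<open>k\<close> of the identity matrix of
  the family \<open>F\<close>; columns index sources, hence a zero morphism from \<open>F k\<close>
  to \<open>F i\<close>.\<close>

definition kronecker where
  "kronecker F i k = (if i = k then Ident C (F i) else Zero C (F k) (F i))"

text \<open>An entry \<open>a j i\<close> is a morphism \<open>F i \<rightarrow> G j\<close>, so that matrix products are formed as usual;
  the product \<open>b a\<close> is the identity matrix.\<close>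

definition left_inverse where
  "left_inverse I F J G a b \<longleftrightarrow>
     (\<forall>i \<in> I. \<forall>j \<in> J. a j i \<in> Hom C (F i) (G j) \<and> b i j \<in> Hom C (G j) (F i)) \<and>
     (\<forall>i \<in> I. \<forall>k \<in> I. hom_sum (F k) (F i) (\<lambda>j. b i j \<cdot> a j k) J = kronecker F i k)"

text \<open>A unit summand of the diagonal entry of \<open>b a\<close> at \<open>i\<close> makes
  some \<open>f = a j i\<close> left invertible, say \<open>g \<cdot> f\<close> is the identity.
  Then \<open>f \<cdot> g\<close> is an idempotent of the local ring of \<open>G j\<close>, so it is
  zero or the identity, and zero is impossible.\<close>

lemma local_iso_entry:
  assumes li: "left_inverse I F J G a b" and "finite J" and "i \<in> I"
    and F: "local_ring (End_ring C (F i))" "F i \<in> Obj C"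
    and G: "\<And>j. j \<in> J \<Longrightarrow> local_ring (End_ring C (G j))"
  obtains j v where "j \<in> J" "v \<in> Hom C (G j) (F i)"
    "a j i \<cdot> v = Ident C (G j)" "v \<cdot> a j i = Ident C (F i)"
proof -
  interpret F: local_ring "End_ring C (F i)" by (rule F)
  have ab: "a j i \<in> Hom C (F i) (G j)" "b i j \<in> Hom C (G j) (F i)" if "j \<in> J" for j
    using li that \<open>i \<in> I\<close> by (auto simp: left_inverse_def)
  have "finsum (End_ring C (F i)) (\<lambda>j. b i j \<cdot> a j i) J = Ident C (F i)"
    using li \<open>i \<in> I\<close> by (simp add: finsum_End_ring left_inverse_def kronecker_def)
  then have "\<exists>j \<in> J. b i j \<cdot> a j i \<in> Units (End_ring C (F i))"
    using \<open>finite J\<close> F.Units_one_closed ab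
    by (intro F.finsum_unit_summand) (auto intro!: Comp_closed)
  then obtain j t where j: "j \<in> J" and t: "t \<in> Hom C (F i) (F i)"
    and tl: "t \<cdot> (b i j \<cdot> a j i) = Ident C (F i)"
    by (auto simp: Units_def)
  define f where "f = a j i"
  \<comment> \<open>The left inverse \<open>t\<close> of the unit \<open>b i j \<cdot> a j i\<close>
    is absorbed into \<open>b i j\<close>.\<close>
  define g where "g = t \<cdot> b i j"
  have f: "f \<in> Hom C (F i) (G j)" using ab j f_def by simp
  have g: "g \<in> Hom C (G j) (F i)" using ab[OF j] t g_def Comp_closed by simp
  have gf: "g \<cdot> f = Ident C (F i)"
    using tl ab[OF j] t by (simp add: f_def g_def Comp_assoc)
  interpret G: local_ring "End_ring C (G j)" by (rule G[OF j])
  have fg: "f \<cdot> g \<in> Hom C (G j) (G j)" using f g Comp_closed by blast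
  have "(f \<cdot> g) \<cdot> (f \<cdot> g) = f \<cdot> ((g \<cdot> f) \<cdot> g)"
    using f g Comp_closed by (metis Comp_assoc)
  also have "\<dots> = f \<cdot> g" using gf g Ident_Comp by simp
  finally have "f \<cdot> g = Zero C (G j) (G j) \<or> f \<cdot> g = Ident C (G j)"
    using G.idempotent_cases[of "f \<cdot> g"] fg by simp
  \<comment> \<open>If \<open>f \<cdot> g\<close> were zero, then
    \<open>f = f \<cdot> g \<cdot> f\<close> and with it \<open>g \<cdot> f\<close>, the identity of
    \<open>F i\<close>, would be zero, against locality of \<open>End_ring C (F i)\<close>.\<close>
  moreover have False if z: "f \<cdot> g = Zero C (G j) (G j)"
  proof -
    have "f = f \<cdot> (g \<cdot> f)" using gf f Comp_Ident by simp
    also have "\<dots> = (f \<cdot> g) \<cdot> f" using Comp_assoc[OF f g f] by simp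
    also have "\<dots> = Zero C (F i) (G j)" using z f Hom_Obj Zero_Comp by metis
    finally have "Ident C (F i) = Zero C (F i) (F i)"
      using gf Comp_Zero[OF g F(2)] by simp
    then show False using F.zero_nonunit F.Units_one_closed by simp
  qed
  ultimately show ?thesis using that[OF j] g gf unfolding f_def by blast
qed

text \<open>The row operations \<open>w j\<close> clear column \<open>i0\<close>; with \<open>z\<close> minus the inverse of the pivot, \<open>w j\<close> is
  minus the usual multiplier, and \<open>w j0\<close> is minus the identity, so row \<open>j0\<close> is annihilated too.\<close>

lemma schur_complement:
  assumes ba: "left_inverse (insert i0 I) F (insert j0 J) G a b"
    and ab: "left_inverse (insert j0 J) G (insert i0 I) F b a"
    and fin: "finite I" "finite J" "i0 \<notin> I" "j0 \<notin> J"
    and F: "\<And>i. i \<in> insert i0 I \<Longrightarrow> F i \<in> Obj C"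
    and G: "\<And>j. j \<in> insert j0 J \<Longrightarrow> G j \<in> Obj C"
    and v: "v \<in> Hom C (G j0) (F i0)"
      "a j0 i0 \<cdot> v = Ident C (G j0)" "v \<cdot> a j0 i0 = Ident C (F i0)"
  shows "\<exists>a'. left_inverse I F J G a' b \<and> left_inverse J G I F b a'"
proof -
  let ?I = "insert i0 I" and ?J = "insert j0 J"
  have a: "a j i \<in> Hom C (F i) (G j)" and b: "b i j \<in> Hom C (G j) (F i)"
    if "i \<in> ?I" "j \<in> ?J" for i j
    using ba that unfolding left_inverse_def by blast+
  have BA: "hom_sum (F k) (F i) (\<lambda>j. b i j \<cdot> a j k) ?J = kronecker F i k"
    if "i \<in> ?I" "k \<in> ?I" for i k
    using ba that unfolding left_inverse_def by blast
  have AB: "hom_sum (G l) (G j) (\<lambda>i. a j i \<cdot> b i l) ?I = kronecker G j l"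
    if "j \<in> ?J" "l \<in> ?J" for j l
    using ab that unfolding left_inverse_def by blast
  obtain z where z: "z \<in> Hom C (G j0) (F i0)"
    and uz: "Ident C (G j0) \<boxplus> a j0 i0 \<cdot> z = Zero C (G j0) (G j0)"
    and zu: "Ident C (F i0) \<boxplus> z \<cdot> a j0 i0 = Zero C (F i0) (F i0)"
    using iso_neg_inverse[OF a[of i0 j0] v] by auto
  define w where "w j = a j i0 \<cdot> z" for j
  \<comment> \<open>The Schur complement of the pivot, the sign being carried by \<open>z\<close>.
    It is defined on the full index sets: row \<open>j0\<close> and column \<open>i0\<close> turn
    out to be zero, so sums over the smaller sets can be enlarged to those in \<open>BA\<close> and
    \<open>AB\<close>.\<close>
  define a' where "a' j i = a j i \<boxplus> w j \<cdot> a j0 i" for j i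
  have w: "w j \<in> Hom C (G j0) (G j)" if "j \<in> ?J" for j
    unfolding w_def using z a that by (blast intro: Comp_closed)
  have wa: "w j \<cdot> a j0 i \<in> Hom C (F i) (G j)" if "i \<in> ?I" "j \<in> ?J" for i j
    using w[OF that(2)] a[OF that(1), of j0] by (auto intro: Comp_closed)
  have a': "a' j i \<in> Hom C (F i) (G j)" if "i \<in> ?I" "j \<in> ?J" for i j
    unfolding a'_def using a wa that by (blast intro: Add_closed)
  have row0: "a' j0 i = Zero C (F i) (G j0)" if i: "i \<in> ?I" for i
  proof -
    have m: "a j0 i \<in> Hom C (F i) (G j0)" using a i by blast
    have "a' j0 i = Ident C (G j0) \<cdot> a j0 i \<boxplus> w j0 \<cdot> a j0 i"
      unfolding a'_def using Ident_Comp[OF m] by simp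
    also have "\<dots> = (Ident C (G j0) \<boxplus> w j0) \<cdot> a j0 i"
      using m w G by (subst Comp_Add_left) (auto intro: Ident_closed)
    also have "\<dots> = Zero C (F i) (G j0)"
      using uz Zero_Comp[OF m] G unfolding w_def by simp
    finally show ?thesis .
  qed
  \<comment> \<open>Here the pivot is cancelled from the source side:
    \<open>z \<cdot> a j0 i0\<close> is minus the identity of \<open>F i0\<close>.\<close>
  have col0: "a' j i0 = Zero C (F i0) (G j)" if j: "j \<in> ?J" for j
  proof -
    have m: "a j i0 \<in> Hom C (F i0) (G j)" "a j0 i0 \<in> Hom C (F i0) (G j0)" using a j by blast+
    have "a' j i0 = a j i0 \<cdot> Ident C (F i0) \<boxplus> a j i0 \<cdot> (z \<cdot> a j0 i0)"
      unfolding a'_def w_def using Comp_Ident[OF m(1)] Comp_assoc[OF m(2) z m(1)] by simp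
    also have "\<dots> = a j i0 \<cdot> (Ident C (F i0) \<boxplus> z \<cdot> a j0 i0)"
      using m z F Ident_closed Comp_closed[OF m(2) z] by (subst Comp_Add_right) auto
    also have "\<dots> = Zero C (F i0) (G j)" using zu Comp_Zero[OF m(1)] F by simp
    finally show ?thesis .
  qed
  \<comment> \<open>The correction changes entry \<open>(i, k)\<close> of \<open>b a\<close> by its
    entry \<open>(i, i0)\<close> followed on the right by the factor
    \<open>z \<cdot> a j0 k\<close>; that entry is zero because \<open>i\<close> differs from
    \<open>i0\<close>.\<close>
  have BA': "hom_sum (F k) (F i) (\<lambda>j. b i j \<cdot> a' j k) J = kronecker F i k"
    if i: "i \<in> I" and k: "k \<in> I" for i k
  proof -
    have ik: "i \<in> ?I" "k \<in> ?I" "i \<noteq> i0" using i k fin by auto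
    have ob: "F k \<in> Obj C" "F i \<in> Obj C" using F ik by auto
    have m: "b i j \<cdot> a' j k \<in> Hom C (F k) (F i)" if "j \<in> ?J" for j
      using a'[OF ik(2) that] b[OF ik(1) that] by (rule Comp_closed)
    have "b i j0 \<cdot> a' j0 k = Zero C (F k) (F i)"
      using row0[OF ik(2)] Comp_Zero[OF b[OF ik(1)], of j0] ob by simp
    then have "hom_sum (F k) (F i) (\<lambda>j. b i j \<cdot> a' j k) ?J
        = hom_sum (F k) (F i) (\<lambda>j. b i j \<cdot> a' j k) J"
      using ob fin m by (subst hom_sum_insert) (auto intro!: Add_Zero hom_sum_closed)
    \<comment> \<open>Rebracketing isolates \<open>z \<cdot> a j0 k\<close>, which does not depend
      on \<open>j\<close> and can be pulled out of the sum.\<close>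
    moreover have "b i j \<cdot> a' j k = b i j \<cdot> a j k \<boxplus> (b i j \<cdot> a j i0) \<cdot> (z \<cdot> a j0 k)"
      if j: "j \<in> ?J" for j
    proof -
      have e: "a j0 k \<in> Hom C (F k) (G j0)" "a j i0 \<in> Hom C (F i0) (G j)" using a ik j by auto
      have "w j \<cdot> a j0 k = a j i0 \<cdot> (z \<cdot> a j0 k)"
        unfolding w_def using Comp_assoc[OF e(1) z e(2)] .
      then have "b i j \<cdot> (w j \<cdot> a j0 k) = (b i j \<cdot> a j i0) \<cdot> (z \<cdot> a j0 k)"
        using Comp_assoc[OF Comp_closed[OF e(1) z] e(2) b[OF ik(1) j]] by simp
      then show ?thesis
        unfolding a'_def using Comp_Add_right[OF a[OF ik(2) j] wa[OF ik(2) j] b[OF ik(1) j]] by simp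
    qed
    then have "hom_sum (F k) (F i) (\<lambda>j. b i j \<cdot> a' j k) ?J
        = hom_sum (F k) (F i) (\<lambda>j. b i j \<cdot> a j k \<boxplus> (b i j \<cdot> a j i0) \<cdot> (z \<cdot> a j0 k)) ?J"
      using ob m by (intro hom_sum_cong) auto
    moreover have za: "z \<cdot> a j0 k \<in> Hom C (F k) (F i0)"
      using Comp_closed[OF a[OF ik(2)] z] by simp
    moreover have ba0: "b i j \<cdot> a j i0 \<in> Hom C (F i0) (F i)" if "j \<in> ?J" for j
      using Comp_closed[OF a b] that ik by blast
    moreover have "hom_sum (F k) (F i) (\<lambda>j. b i j \<cdot> a j k \<boxplus> (b i j \<cdot> a j i0) \<cdot> (z \<cdot> a j0 k)) ?J
        = hom_sum (F k) (F i) (\<lambda>j. b i j \<cdot> a j k) ?J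
          \<boxplus> hom_sum (F k) (F i) (\<lambda>j. (b i j \<cdot> a j i0) \<cdot> (z \<cdot> a j0 k)) ?J"
      using ob Comp_closed[OF a[OF ik(2)] b[OF ik(1)]] Comp_closed[OF za ba0]
      by (intro hom_sum_Add) auto
    moreover have "hom_sum (F k) (F i) (\<lambda>j. (b i j \<cdot> a j i0) \<cdot> (z \<cdot> a j0 k)) ?J
        = hom_sum (F i0) (F i) (\<lambda>j. b i j \<cdot> a j i0) ?J \<cdot> (z \<cdot> a j0 k)"
      using ob fin za ba0 by (intro hom_sum_Comp[symmetric]) auto
    moreover have "\<dots> = Zero C (F k) (F i)"
      using BA[OF ik(1), of i0] ik(3) Zero_Comp[OF za] ob by (simp add: kronecker_def)
    moreover have "kronecker F i k \<in> Hom C (F k) (F i)"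
      using ob by (auto simp: kronecker_def intro: Ident_closed Zero_closed)
    ultimately show ?thesis using BA[OF ik(1,2)] Add_Zero by simp
  qed
  \<comment> \<open>The mirror computation: the factor \<open>w j\<close> comes out on the left, and
    what remains is entry \<open>(j0, l)\<close> of \<open>a b\<close>, zero because
    \<open>l\<close> differs from \<open>j0\<close>.\<close>
  have AB': "hom_sum (G l) (G j) (\<lambda>i. a' j i \<cdot> b i l) I = kronecker G j l"
    if j: "j \<in> J" and l: "l \<in> J" for j l
  proof -
    have jl: "j \<in> ?J" "l \<in> ?J" "l \<noteq> j0" using j l fin by auto
    have ob: "G l \<in> Obj C" "G j \<in> Obj C" using G jl by auto
    have m: "a' j i \<cdot> b i l \<in> Hom C (G l) (G j)" if "i \<in> ?I" for i
      using b[OF that jl(2)] a'[OF that jl(1)] by (rule Comp_closed)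
    have "a' j i0 \<cdot> b i0 l = Zero C (G l) (G j)"
      using col0[OF jl(1)] Zero_Comp[OF b[OF _ jl(2)], of i0] ob by simp
    then have "hom_sum (G l) (G j) (\<lambda>i. a' j i \<cdot> b i l) ?I
        = hom_sum (G l) (G j) (\<lambda>i. a' j i \<cdot> b i l) I"
      using ob fin m by (subst hom_sum_insert) (auto intro!: Add_Zero hom_sum_closed)
    moreover have "a' j i \<cdot> b i l = a j i \<cdot> b i l \<boxplus> w j \<cdot> (a j0 i \<cdot> b i l)"
      if i: "i \<in> ?I" for i
      unfolding a'_def
      using Comp_Add_left[OF b[OF i jl(2)] a[OF i jl(1)] wa[OF i jl(1)]]
        Comp_assoc[OF b[OF i jl(2)] a[OF i] w[OF jl(1)]] by simp
    then have "hom_sum (G l) (G j) (\<lambda>i. a' j i \<cdot> b i l) ?I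
        = hom_sum (G l) (G j) (\<lambda>i. a j i \<cdot> b i l \<boxplus> w j \<cdot> (a j0 i \<cdot> b i l)) ?I"
      using ob m by (intro hom_sum_cong) auto
    moreover have ab0: "a j0 i \<cdot> b i l \<in> Hom C (G l) (G j0)" if "i \<in> ?I" for i
      using Comp_closed[OF b a] that jl by blast
    moreover have "hom_sum (G l) (G j) (\<lambda>i. a j i \<cdot> b i l \<boxplus> w j \<cdot> (a j0 i \<cdot> b i l)) ?I
        = hom_sum (G l) (G j) (\<lambda>i. a j i \<cdot> b i l) ?I
          \<boxplus> hom_sum (G l) (G j) (\<lambda>i. w j \<cdot> (a j0 i \<cdot> b i l)) ?I"
      using ob Comp_closed[OF b[OF _ jl(2)] a[OF _ jl(1)]] Comp_closed[OF ab0 w[OF jl(1)]]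
      by (intro hom_sum_Add) auto
    moreover have "hom_sum (G l) (G j) (\<lambda>i. w j \<cdot> (a j0 i \<cdot> b i l)) ?I
        = w j \<cdot> hom_sum (G l) (G j0) (\<lambda>i. a j0 i \<cdot> b i l) ?I"
      using ob fin ab0 w[OF jl(1)] by (intro Comp_hom_sum[symmetric]) auto
    moreover have "\<dots> = Zero C (G l) (G j)"
      using AB[OF _ jl(2), of j0] jl(3) Comp_Zero[OF w[OF jl(1)]] ob by (simp add: kronecker_def)
    moreover have "kronecker G j l \<in> Hom C (G l) (G j)"
      using ob by (auto simp: kronecker_def intro: Ident_closed Zero_closed)
    ultimately show ?thesis using AB[OF jl(1,2)] Add_Zero by simp
  qed
  show ?thesis
    using BA' AB' a' b unfolding left_inverse_def by (intro exI[of _ a']) auto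
qed

text \<open>Each induction step matches \<open>i0\<close> with the row \<open>j0\<close> of an
  isomorphism entry and passes to the Schur complement. This changes \<open>J\<close> and
  \<open>a\<close> but only restricts \<open>b\<close>, so \<open>b\<close> stays fixed in the
  induction.\<close>

lemma inverse_matrices_bij:
  assumes "finite I" "finite J"
    and "left_inverse I F J G a b" "left_inverse J G I F b a"
    and "\<And>i. i \<in> I \<Longrightarrow> F i \<in> Obj C \<and> local_ring (End_ring C (F i))"
    and "\<And>j. j \<in> J \<Longrightarrow> G j \<in> Obj C \<and> local_ring (End_ring C (G j))"
  shows "\<exists>f. bij_betw f I J \<and> (\<forall>i \<in> I. isomorphic C (F i) (G (f i)))"
  using assms
proof (induction I arbitrary: J a rule: finite_induct)
  case empty
  \<comment> \<open>For \<open>j\<close> in \<open>J\<close>, the diagonal entry of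
    \<open>a b\<close> is an empty sum, so the identity of \<open>G j\<close> would be zero.\<close>
  have "J = {}"
  proof (rule ccontr)
    assume "J \<noteq> {}"
    then obtain j where j: "j \<in> J" by blast
    interpret local_ring "End_ring C (G j)" using empty j by blast
    have "Ident C (G j) = Zero C (G j) (G j)"
      using empty.prems(3,5) j hom_sum_empty[of "G j" "G j"]
      unfolding left_inverse_def kronecker_def by (metis (full_types))
    then show False using zero_nonunit Units_one_closed by simp
  qed
  then show ?case by (auto simp: bij_betw_def)
next
  case (insert i0 I)
  obtain j0 v where j0: "j0 \<in> J" and v: "v \<in> Hom C (G j0) (F i0)"
    "a j0 i0 \<cdot> v = Ident C (G j0)" "v \<cdot> a j0 i0 = Ident C (F i0)"
    using local_iso_entry[OF insert.prems(2,1), of i0] insert.prems(4,5) by blast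
  define J' where "J' = J - {j0}"
  have J': "J = insert j0 J'" "j0 \<notin> J'" "finite J'" using j0 insert.prems by (auto simp: J'_def)
  have "\<exists>a'. left_inverse I F J' G a' b \<and> left_inverse J' G I F b a'"
    using insert.prems insert.hyps J' v
    by (intro schur_complement[where ?i0.0 = i0 and ?j0.0 = j0 and a = a and v = v]) auto
  then obtain a' where "left_inverse I F J' G a' b" "left_inverse J' G I F b a'" by blast
  then obtain f where f: "bij_betw f I J'" "\<forall>i \<in> I. isomorphic C (F i) (G (f i))"
    using insert.IH[of J' a'] insert.prems J' by auto
  have "a j0 i0 \<in> Hom C (F i0) (G j0)"
    using insert.prems(2) j0 by (simp add: left_inverse_def)
  then have "isomorphic C (F i0) (G j0)" using v unfolding isomorphic_def by blast
  then have "\<forall>i \<in> insert i0 I. isomorphic C (F i) (G ((f(i0 := j0)) i))"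
    using f(2) insert.hyps by auto
  moreover have "bij_betw (f(i0 := j0)) (insert i0 I) J"
  proof -
    have "bij_betw (f(i0 := j0)) I J'"
      using f(1) insert.hyps by (subst bij_betw_cong[of _ _ f]) auto
    then show ?thesis
      using notIn_Un_bij_betw[of i0 I "f(i0 := j0)" J'] insert.hyps J' by auto
  qed
  ultimately show ?case by blast
qed

section \<open>From biproduct decompositions to inverse matrices\<close>

text \<open>In \<open>\<pi> i \<cdot> \<kappa> j \<cdot> \<rho> j \<cdot> \<iota> k\<close>, summing
  over \<open>j\<close> replaces the middle by the identity of \<open>X\<close>, leaving
  \<open>\<pi> i \<cdot> \<iota> k\<close>. Exchanging the two families yields the other inverse
  relation.\<close>

lemma left_inverse_of_biproducts:
  assumes X: "X \<in> Obj C" and fin: "finite J"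
    and F: "\<And>i. i \<in> I \<Longrightarrow> \<iota> i \<in> Hom C (F i) X \<and> \<pi> i \<in> Hom C X (F i)"
    and G: "\<And>j. j \<in> J \<Longrightarrow> \<kappa> j \<in> Hom C (G j) X \<and> \<rho> j \<in> Hom C X (G j)"
    and orth: "\<And>i k. i \<in> I \<Longrightarrow> k \<in> I \<Longrightarrow> \<pi> i \<cdot> \<iota> k = kronecker F i k"
    and sum: "hom_sum X X (\<lambda>j. \<kappa> j \<cdot> \<rho> j) J = Ident C X"
  shows "left_inverse I F J G (\<lambda>j i. \<rho> j \<cdot> \<iota> i) (\<lambda>i j. \<pi> i \<cdot> \<kappa> j)"
proof -
  have "hom_sum (F k) (F i) (\<lambda>j. (\<pi> i \<cdot> \<kappa> j) \<cdot> (\<rho> j \<cdot> \<iota> k)) J = kronecker F i k"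
    if i: "i \<in> I" and k: "k \<in> I" for i k
  proof -
    have m: "\<iota> k \<in> Hom C (F k) X" "\<pi> i \<in> Hom C X (F i)" using F i k by auto
    have ob: "F k \<in> Obj C" "F i \<in> Obj C" using m Hom_Obj by blast+
    have kr: "\<kappa> j \<cdot> \<rho> j \<in> Hom C X X" if "j \<in> J" for j using G that Comp_closed by blast
    have e: "(\<pi> i \<cdot> \<kappa> j) \<cdot> (\<rho> j \<cdot> \<iota> k) = \<pi> i \<cdot> ((\<kappa> j \<cdot> \<rho> j) \<cdot> \<iota> k)" if "j \<in> J" for j
    proof -
      have g: "\<kappa> j \<in> Hom C (G j) X" "\<rho> j \<in> Hom C X (G j)" using G that by auto
      show ?thesis
        using Comp_assoc[OF m(1) g(2) g(1)] Comp_assoc[OF Comp_closed[OF m(1) g(2)] g(1) m(2)]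
        by simp
    qed
    have "hom_sum (F k) (F i) (\<lambda>j. (\<pi> i \<cdot> \<kappa> j) \<cdot> (\<rho> j \<cdot> \<iota> k)) J
        = hom_sum (F k) (F i) (\<lambda>j. \<pi> i \<cdot> ((\<kappa> j \<cdot> \<rho> j) \<cdot> \<iota> k)) J"
      using ob e Comp_closed[OF Comp_closed[OF m(1) kr] m(2)] by (intro hom_sum_cong) auto
    also have "\<dots> = \<pi> i \<cdot> hom_sum (F k) X (\<lambda>j. (\<kappa> j \<cdot> \<rho> j) \<cdot> \<iota> k) J"
      using ob fin m Comp_closed[OF m(1) kr] by (intro Comp_hom_sum[symmetric]) auto
    also have "\<dots> = \<pi> i \<cdot> (hom_sum X X (\<lambda>j. \<kappa> j \<cdot> \<rho> j) J \<cdot> \<iota> k)"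
      using hom_sum_Comp[OF X m(1) fin kr] by simp
    also have "\<dots> = kronecker F i k" using sum orth i k Ident_Comp[OF m(1)] by simp
    finally show ?thesis .
  qed
  moreover have "\<rho> j \<cdot> \<iota> i \<in> Hom C (F i) (G j)" "\<pi> i \<cdot> \<kappa> j \<in> Hom C (G j) (F i)"
    if "i \<in> I" "j \<in> J" for i j
    using F[OF that(1)] G[OF that(2)] Comp_closed by blast+
  ultimately show ?thesis by (simp add: left_inverse_def)
qed

lemma direct_sum_decompositionE:
  assumes "direct_sum_decomposition C X r Xs"
  obtains \<iota> \<pi> where "\<And>i. i \<in> {1..r} \<Longrightarrow> \<iota> i \<in> Hom C (Xs i) X \<and> \<pi> i \<in> Hom C X (Xs i)"
    and "hom_sum X X (\<lambda>i. \<iota> i \<cdot> \<pi> i) {1..r} = Ident C X"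
    and "\<And>i k. i \<in> {1..r} \<Longrightarrow> k \<in> {1..r} \<Longrightarrow> \<pi> i \<cdot> \<iota> k = kronecker Xs i k"
proof -
  obtain \<iota> \<pi> where d: "\<forall>i \<in> {1..r}. \<iota> i \<in> Hom C (Xs i) X \<and> \<pi> i \<in> Hom C X (Xs i)"
    "finsum (End_ring C X) (\<lambda>i. \<iota> i \<cdot> \<pi> i) {1..r} = Ident C X"
    "\<forall>i \<in> {1..r}. \<pi> i \<cdot> \<iota> i = Ident C (Xs i)"
    "\<forall>i \<in> {1..r}. \<forall>j \<in> {1..r}. i \<noteq> j \<longrightarrow> \<pi> j \<cdot> \<iota> i = Zero C (Xs i) (Xs j)"
    using assms unfolding direct_sum_decomposition_def by blast
  show ?thesis
  proof (rule that)
    show "hom_sum X X (\<lambda>i. \<iota> i \<cdot> \<pi> i) {1..r} = Ident C X" using d(2) unfolding finsum_End_ring .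
    show "\<pi> i \<cdot> \<iota> k = kronecker Xs i k" if "i \<in> {1..r}" "k \<in> {1..r}" for i k
      using d(3,4) that unfolding kronecker_def by (cases "i = k") auto
  qed (use d(1) in blast)
qed

end

theorem theorem4p2:
  fixes C :: "('o, 'm) preadditive_category"
    and X :: 'o
    and Xs Ys :: "nat \<Rightarrow> 'o"
    and r s :: nat
  assumes "additive_category C"
    and "X \<in> Obj C"
    and "direct_sum_decomposition C X r Xs"
    and "direct_sum_decomposition C X s Ys"
    and "\<forall>i \<in> {1..r}. local_ring (End_ring C (Xs i))"
    and "\<forall>j \<in> {1..s}. local_ring (End_ring C (Ys j))"
  shows "r = s \<and> (\<exists>p. p permutes {1..r} \<and> (\<forall>i \<in> {1..r}. isomorphic C (Xs i) (Ys (p i))))"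
proof -
  interpret additive_category C by (rule assms(1))
  obtain \<iota> \<pi> where x: "\<And>i. i \<in> {1..r} \<Longrightarrow> \<iota> i \<in> Hom C (Xs i) X \<and> \<pi> i \<in> Hom C X (Xs i)"
    "hom_sum X X (\<lambda>i. Comp C (\<iota> i) (\<pi> i)) {1..r} = Ident C X"
    "\<And>i k. i \<in> {1..r} \<Longrightarrow> k \<in> {1..r} \<Longrightarrow> Comp C (\<pi> i) (\<iota> k) = kronecker Xs i k"
    using direct_sum_decompositionE[OF assms(3)] by blast
  obtain \<kappa> \<rho> where y: "\<And>j. j \<in> {1..s} \<Longrightarrow> \<kappa> j \<in> Hom C (Ys j) X \<and> \<rho> j \<in> Hom C X (Ys j)"
    "hom_sum X X (\<lambda>j. Comp C (\<kappa> j) (\<rho> j)) {1..s} = Ident C X"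
    "\<And>j l. j \<in> {1..s} \<Longrightarrow> l \<in> {1..s} \<Longrightarrow> Comp C (\<rho> j) (\<kappa> l) = kronecker Ys j l"
    using direct_sum_decompositionE[OF assms(4)] by blast
  have "\<exists>f. bij_betw f {1..r} {1..s} \<and> (\<forall>i \<in> {1..r}. isomorphic C (Xs i) (Ys (f i)))"
  proof (rule inverse_matrices_bij)
    show "left_inverse {1..r} Xs {1..s} Ys
        (\<lambda>j i. Comp C (\<rho> j) (\<iota> i)) (\<lambda>i j. Comp C (\<pi> i) (\<kappa> j))"
      by (rule left_inverse_of_biproducts[OF assms(2) _ x(1) y(1) x(3) y(2)]) auto
    show "left_inverse {1..s} Ys {1..r} Xs
        (\<lambda>i j. Comp C (\<pi> i) (\<kappa> j)) (\<lambda>j i. Comp C (\<rho> j) (\<iota> i))"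
      by (rule left_inverse_of_biproducts[OF assms(2) _ y(1) x(1) y(3) x(2)]) auto
  qed (use assms(3-6) in \<open>auto simp: direct_sum_decomposition_def\<close>)
  then obtain f where f: "bij_betw f {1..r} {1..s}"
    "\<forall>i \<in> {1..r}. isomorphic C (Xs i) (Ys (f i))" by blast
  have rs: "r = s" using bij_betw_same_card[OF f(1)] by simp
  \<comment> \<open>The predicate \<open>permutes\<close> demands that every number outside
    \<open>{1..r}\<close> be fixed, so \<open>f\<close> is extended by the identity.\<close>
  define p where "p i = (if i \<in> {1..r} then f i else i)" for i
  have "bij_betw p {1..r} {1..r}"
    using f(1) rs by (subst bij_betw_cong[of _ _ f]) (auto simp: p_def)
  then have "p permutes {1..r}" by (rule bij_imp_permutes) (auto simp: p_def)
  then show ?thesis using rs f(2) by (auto simp: p_def)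
qed

end
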